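(* Let $(\mathfrak g,\omega)$ be a nilpotent symplectic Lie algebra which admits a central element $H$ such that the symplectic reduction $\bar{\mathfrak g}=H^{\perp}/\langle H\rangle$ is abelian. Then $(\mathfrak g,\omega)$ has a Lagrangian ideal.
   Context: All Lie algebras are finite-dimensional over a fixed field $k$ of characteristic $0$. A symplectic Lie algebra $(\mathfrak g,\omega)$ is a Lie algebra with a non-degenerate alternating form $\omega$ satisfying $\omega([u,v],w)+\omega([w,u],v)+\omega([v,w],u)=0$; it is called nilpotent if $\mathfrak g$ is nilpotent. $H^\perp=\{v\in\mathfrak g:\omega(v,H)=0\}$; since $H$ is central this is an ideal of $\mathfrak g$ containing the central ideal $\langle H\rangle$ (the span of $H$), and $\bar{\mathfrak g}=H^\perp/\langle H\rangle$ is the quotient Lie algebra. A Lagrangian ideal is an ideal of $\mathfrak g$ equal to its $\omega$-orthogonal. *)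

theory Defs
  imports Complex_Main
begin

text \<open>
  The ground field is a type \<open>'k\<close> of class \<^class>\<open>field_char_0\<close>; the underlying space of the Lie
  algebra is the whole type \<open>'v\<close>, made into a \<open>'k\<close>-vector space by \<open>scale\<close>.
\<close>

locale lie_algebra = vector_space scale
  for scale :: "'k::field_char_0 \<Rightarrow> 'v::ab_group_add \<Rightarrow> 'v" (infixr "*s" 75) +
  fixes bracket :: "'v \<Rightarrow> 'v \<Rightarrow> 'v"
  assumes finite_dim: "\<exists>B. finite B \<and> span B = UNIV"
    and linear_bracket_left: "\<And>y. Vector_Spaces.linear scale scale (\<lambda>x. bracket x y)"
    and linear_bracket_right: "\<And>x. Vector_Spaces.linear scale scale (\<lambda>y. bracket x y)"
    and bracket_self: "\<And>x. bracket x x = 0"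
    and jacobi: "\<And>x y z. bracket x (bracket y z) + bracket y (bracket z x) + bracket z (bracket x y) = 0"
begin

definition lie_subalgebra :: "'v set \<Rightarrow> bool" where
  "lie_subalgebra W \<longleftrightarrow> subspace W \<and> (\<forall>x\<in>W. \<forall>y\<in>W. bracket x y \<in> W)"

definition ideal_of :: "'v set \<Rightarrow> 'v set \<Rightarrow> bool" where
  "ideal_of W I \<longleftrightarrow> subspace I \<and> I \<subseteq> W \<and> (\<forall>x\<in>W. \<forall>y\<in>I. bracket x y \<in> I)"

abbreviation lie_ideal :: "'v set \<Rightarrow> bool" where
  "lie_ideal \<equiv> ideal_of UNIV"

definition central :: "'v \<Rightarrow> bool" where
  "central z \<longleftrightarrow> (\<forall>x. bracket z x = 0)"

primrec lower_central_series :: "nat \<Rightarrow> 'v set" where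
  "lower_central_series 0 = UNIV"
| "lower_central_series (Suc n) = span {bracket x y | x y. y \<in> lower_central_series n}"

definition nilpotent_lie :: bool where
  "nilpotent_lie \<longleftrightarrow> (\<exists>n. lower_central_series n = {0})"

text \<open>
  The quotient \<open>W/I\<close> of a subalgebra \<open>W\<close> by an ideal \<open>I\<close> of \<open>W\<close>, as a set of cosets. Commutativity
  refers only to the zero and the bracket of the quotient, so its other operations are not named.
\<close>

definition coset_rel :: "'v set \<Rightarrow> 'v set \<Rightarrow> ('v \<times> 'v) set" where
  "coset_rel W I = {(x, y). x \<in> W \<and> y \<in> W \<and> x - y \<in> I}"

definition quotient_carrier :: "'v set \<Rightarrow> 'v set \<Rightarrow> 'v set set" where
  "quotient_carrier W I = W // coset_rel W I"

definition quotient_zero :: "'v set \<Rightarrow> 'v set \<Rightarrow> 'v set" where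
  "quotient_zero W I = coset_rel W I `` {0}"

definition quotient_bracket :: "'v set \<Rightarrow> 'v set \<Rightarrow> 'v set \<Rightarrow> 'v set \<Rightarrow> 'v set" where
  "quotient_bracket W I A B = (\<Union>x\<in>A. \<Union>y\<in>B. coset_rel W I `` {bracket x y})"

definition quotient_abelian :: "'v set \<Rightarrow> 'v set \<Rightarrow> bool" where
  "quotient_abelian W I \<longleftrightarrow>
    (\<forall>A\<in>quotient_carrier W I. \<forall>B\<in>quotient_carrier W I. quotient_bracket W I A B = quotient_zero W I)"

lemma equiv_coset_rel:
  assumes "subspace I"
  shows "equiv W (coset_rel W I)"
proof (rule equivI)
  show "coset_rel W I \<subseteq> W \<times> W" by (auto simp: coset_rel_def)
  show "refl_on W (coset_rel W I)"
    using subspace_0[OF assms] by (auto simp: coset_rel_def refl_on_def)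
  show "sym (coset_rel W I)"
    using subspace_neg[OF assms] by (force simp: coset_rel_def sym_def)
  show "trans (coset_rel W I)"
    using subspace_add[OF assms] by (force simp: coset_rel_def trans_def)
qed

lemma bracket_diff:
  "bracket (x - x') y = bracket x y - bracket x' y"
  "bracket x (y - y') = bracket x y - bracket x y'"
  using module_hom.diff[OF linear_bracket_left[of y, unfolded module_hom_iff_linear[symmetric]]]
    module_hom.diff[OF linear_bracket_right[of x, unfolded module_hom_iff_linear[symmetric]]]
  by simp_all

lemma bracket_skew: "bracket x y = - bracket y x"
proof -
  have "bracket (x - y) (x - y) = - (bracket x y + bracket y x)"
    unfolding bracket_diff by (simp add: bracket_self)
  then have "bracket x y + bracket y x = 0" by (metis bracket_self neg_equal_0_iff_equal)
  then show ?thesis by (rule eq_neg_iff_add_eq_0[THEN iffD2])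
qed

text \<open>The bracket of \<open>W/I\<close> does not depend on representatives.\<close>

lemma bracket_respects_coset_rel:
  assumes W: "lie_subalgebra W" and I: "ideal_of W I"
  shows "(\<lambda>x y. coset_rel W I `` {bracket x y}) respects2 coset_rel W I"
proof (rule congruent2I')
  fix x x' y y'
  assume "(x, x') \<in> coset_rel W I" "(y, y') \<in> coset_rel W I"
  then have m: "x \<in> W" "x' \<in> W" "x - x' \<in> I" "y \<in> W" "y' \<in> W" "y - y' \<in> I"
    by (auto simp: coset_rel_def)
  have sub: "subspace I" using I by (simp add: ideal_of_def)
  have "bracket y (x - x') \<in> I" "bracket x' (y - y') \<in> I"
    using I m by (auto simp: ideal_of_def)
  then have "- bracket y (x - x') + bracket x' (y - y') \<in> I"
    using sub by (intro subspace_add subspace_neg)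
  moreover have "- bracket y (x - x') + bracket x' (y - y') = bracket x y - bracket x' y'"
    using bracket_skew[of y x] bracket_skew[of y x'] by (simp add: bracket_diff)
  ultimately have "(bracket x y, bracket x' y') \<in> coset_rel W I"
    using W m by (auto simp: coset_rel_def lie_subalgebra_def)
  then show "coset_rel W I `` {bracket x y} = coset_rel W I `` {bracket x' y'}"
    using equiv_class_eq[OF equiv_coset_rel[OF sub]] by blast
qed

lemma quotient_bracket_coset:
  assumes "lie_subalgebra W" "ideal_of W I" "x \<in> W" "y \<in> W"
  shows "quotient_bracket W I (coset_rel W I `` {x}) (coset_rel W I `` {y}) = coset_rel W I `` {bracket x y}"
  unfolding quotient_bracket_def
  using UN_equiv_class2[OF equiv_coset_rel equiv_coset_rel bracket_respects_coset_rel] assms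
  by (simp add: ideal_of_def)

end

locale symplectic_lie_algebra = lie_algebra scale bracket
  for scale :: "'k::field_char_0 \<Rightarrow> 'v::ab_group_add \<Rightarrow> 'v" (infixr "*s" 75)
    and bracket :: "'v \<Rightarrow> 'v \<Rightarrow> 'v" +
  fixes \<omega> :: "'v \<Rightarrow> 'v \<Rightarrow> 'k"
  assumes linear_form_left: "\<And>v. Vector_Spaces.linear scale (*) (\<lambda>u. \<omega> u v)"
    and linear_form_right: "\<And>u. Vector_Spaces.linear scale (*) (\<lambda>v. \<omega> u v)"
    and form_self: "\<And>u. \<omega> u u = 0"
    and nondegenerate: "\<And>u. (\<forall>v. \<omega> u v = 0) \<Longrightarrow> u = 0"
    and closed_form: "\<And>u v w. \<omega> (bracket u v) w + \<omega> (bracket w u) v + \<omega> (bracket v w) u = 0"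
begin

definition orth :: "'v set \<Rightarrow> 'v set" where
  "orth S = {v. \<forall>s\<in>S. \<omega> v s = 0}"

definition reduction_abelian :: "'v \<Rightarrow> bool" where
  "reduction_abelian H \<longleftrightarrow> quotient_abelian (orth {H}) (span {H})"

definition lagrangian_ideal :: "'v set \<Rightarrow> bool" where
  "lagrangian_ideal L \<longleftrightarrow> lie_ideal L \<and> orth L = L"

lemma form_hom_left: "module_hom scale (*) (\<lambda>u. \<omega> u v)"
  using linear_form_left by (simp add: module_hom_iff_linear)

lemma subspace_orth: "subspace (orth S)"
  using module_hom.zero[OF form_hom_left] module_hom.add[OF form_hom_left]
    module_hom.scale[OF form_hom_left]
  by (auto simp: subspace_def orth_def)

text \<open>For central \<open>H\<close> the data entering \<open>reduction_abelian\<close> do form a quotient Lie algebra.\<close>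

lemma lie_ideal_orth_central:
  assumes "central H"
  shows "lie_ideal (orth {H})"
proof -
  have z: "\<omega> 0 v = 0" for v
    by (rule module_hom.zero[OF form_hom_left])
  have "bracket v H = 0" for v
    using assms bracket_skew[of v H] by (simp add: central_def)
  then have "\<omega> (bracket x v) H = 0" for x v
    using closed_form[of x v H] assms by (simp add: central_def z)
  then show ?thesis by (simp add: ideal_of_def subspace_orth) (simp add: orth_def)
qed

lemma ideal_of_orth_span_central:
  assumes "central H"
  shows "ideal_of (orth {H}) (span {H})"
proof -
  have "H \<in> orth {H}" by (simp add: orth_def form_self)
  then have "span {H} \<subseteq> orth {H}" by (simp add: span_minimal subspace_orth)
  moreover have "bracket x y = 0" if y: "y \<in> span {H}" for x y
  proof -
    obtain c where "y = c *s H" using y by (auto simp: span_singleton)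
    moreover have "bracket x (c *s H) = c *s bracket x H"
      by (rule module_hom.scale[OF linear_bracket_right[of x, unfolded module_hom_iff_linear[symmetric]]])
    ultimately show ?thesis
      using assms bracket_skew[of x H] by (simp add: central_def)
  qed
  ultimately show ?thesis by (simp add: ideal_of_def span_zero)
qed

end

end

theory Submission
  imports Defs
begin

text \<open>
  Consider the ideals \<open>L\<close> containing \<open>H\<close> with \<open>L \<subseteq> L\<^sup>\<bottom>\<close> and \<open>[L\<^sup>\<bottom>, L] = 0\<close>, such as the span
  of \<open>H\<close>; for them \<open>L\<^sup>\<bottom>\<close> is an ideal as well. One of maximal dimension is Lagrangian. Indeed, let
  \<open>L \<noteq> L\<^sup>\<bottom>\<close> and let \<open>K\<close> be the centre of \<open>L\<^sup>\<bottom>\<close>. If \<open>K\<close> is not contained in \<open>L\<close>, nilpotency gives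
  \<open>v \<in> K - L\<close> with \<open>[\<gg>, v] \<subseteq> L\<close>, and \<open>L\<close> can be enlarged by \<open>v\<close>.

  To see that \<open>K\<close> is not contained in \<open>L\<close>, suppose \<open>H \<noteq> 0\<close>, pick \<open>\<xi>\<close> with \<open>\<omega>(H, \<xi>) \<noteq> 0\<close> and put
  \<open>D = [\<xi>, _]\<close>. As the reduction is abelian, \<open>[u, v]\<close> is a multiple of \<open>H\<close> for \<open>u, v \<in> L\<^sup>\<bottom>\<close>, so that
  \<open>c(u, v) = \<omega>([u, v], \<xi>)\<close> detects its vanishing. By closedness \<open>\<omega>(Du, v) + \<omega>(u, Dv) = - c(u, v)\<close>,
  and by the Jacobi identity \<open>c(Du, v) + c(u, Dv) = 0\<close>. If \<open>n\<close> is minimal with \<open>D\<^sup>n L\<^sup>\<bottom> \<subseteq> L\<close>,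
  summing these relations over the terms \<open>\<omega>(D\<^sup>iu, D\<^sup>jv)\<close>, \<open>i + j = n\<close>, gives \<open>n c(D\<^sup>n\<^sup>-\<^sup>1u, v) = 0\<close>,
  so that \<open>D\<^sup>n\<^sup>-\<^sup>1 L\<^sup>\<bottom> \<subseteq> K\<close>.
\<close>

section \<open>Lower central series, quotients and maximal subspaces\<close>

context lie_algebra
begin

lemma bracket_zero [simp]: "bracket 0 y = 0" "bracket x 0 = 0"
  using bracket_diff(1)[of 0 0 y] bracket_diff(2)[of x 0 0] by simp_all

lemma bracket_add:
  "bracket (x + x') y = bracket x y + bracket x' y"
  "bracket x (y + y') = bracket x y + bracket x y'"
  using module_hom.add[OF linear_bracket_left[of y, unfolded module_hom_iff_linear[symmetric]]]
    module_hom.add[OF linear_bracket_right[of x, unfolded module_hom_iff_linear[symmetric]]]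
  by simp_all

lemma bracket_scale:
  "bracket (a *s x) y = a *s bracket x y"
  "bracket x (a *s y) = a *s bracket x y"
  using module_hom.scale[OF linear_bracket_left[of y, unfolded module_hom_iff_linear[symmetric]]]
    module_hom.scale[OF linear_bracket_right[of x, unfolded module_hom_iff_linear[symmetric]]]
  by simp_all

lemma bracket_leibniz:
  "bracket x (bracket u v) = bracket (bracket x u) v + bracket u (bracket x v)"
proof -
  have "bracket v (bracket x u) = - bracket (bracket x u) v"
    by (rule bracket_skew)
  moreover have "bracket u (bracket v x) = - bracket u (bracket x v)"
    using bracket_skew[of v x] bracket_diff(2)[of u 0 "bracket x v"] by simp
  ultimately show ?thesis
    using jacobi[of x u v] by (simp add: algebra_simps)
qed

lemma bracket_in_lower_central_series:
  "y \<in> lower_central_series n \<Longrightarrow> bracket x y \<in> lower_central_series (Suc n)"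
  by (auto intro: span_base)

lemma funpow_bracket_in_lower_central_series:
  "(bracket x ^^ n) y \<in> lower_central_series n"
proof (induction n)
  case (Suc n)
  then show ?case
    using bracket_in_lower_central_series by simp
qed simp

text \<open>Take \<open>v\<close> in the last term of the lower central series that meets
  \<open>K\<close> outside \<open>L\<close>: a further bracket stays in \<open>K\<close> and falls
  into the next term.\<close>

lemma nilpotent_exists_central_modulo:
  assumes nil: nilpotent_lie and K: "lie_ideal K" and L: "lie_ideal L" and "\<not> K \<subseteq> L"
  shows "\<exists>v\<in>K. v \<notin> L \<and> (\<forall>x. bracket x v \<in> L)"
proof -
  have 0: "0 \<in> L" using L by (simp add: ideal_of_def subspace_0)
  define P where "P n \<longleftrightarrow> K \<inter> lower_central_series n \<subseteq> L" for n
  obtain n where "lower_central_series n = {0}"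
    using nil by (auto simp: nilpotent_lie_def)
  then have "P n" using 0 by (auto simp: P_def)
  moreover have "\<not> P 0" using assms(4) by (simp add: P_def)
  ultimately obtain m where m: "\<not> P m" "P (Suc m)"
    using ex_least_nat_less[of P n] by auto
  then obtain v where v: "v \<in> K" "v \<in> lower_central_series m" "v \<notin> L"
    by (auto simp: P_def)
  have "bracket x v \<in> K" for x
    using K v(1) by (simp add: ideal_of_def)
  moreover have "bracket x v \<in> lower_central_series (Suc m)" for x
    using v(2) by (rule bracket_in_lower_central_series)
  ultimately have "bracket x v \<in> L" for x
    using m(2) by (auto simp: P_def)
  with v show ?thesis by blast
qed

lemma quotient_abelian_imp_bracket_mem:
  assumes "lie_subalgebra W" "ideal_of W I" "quotient_abelian W I" "x \<in> W" "y \<in> W"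
  shows "bracket x y \<in> I"
proof -
  have carrier: "coset_rel W I `` {z} \<in> quotient_carrier W I" if "z \<in> W" for z
    using that by (simp add: quotient_carrier_def quotientI)
  have "coset_rel W I `` {bracket x y} = coset_rel W I `` {0}"
    using assms carrier quotient_bracket_coset[of W I x y]
    by (simp add: quotient_abelian_def quotient_zero_def)
  moreover have "bracket x y \<in> W" "0 \<in> I"
    using assms by (auto simp: lie_subalgebra_def ideal_of_def subspace_0)
  ultimately have "(0, bracket x y) \<in> coset_rel W I"
    by (auto simp: coset_rel_def)
  then have "- bracket x y \<in> I"
    by (simp add: coset_rel_def)
  then show ?thesis
    using assms(2) subspace_neg[of I "- bracket x y"] by (simp add: ideal_of_def)
qed

lemma exists_maximal_subspace:
  assumes "Q S0" and "\<And>S. Q S \<Longrightarrow> subspace S"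
  shows "\<exists>S. Q S \<and> (\<forall>T. Q T \<longrightarrow> S \<subseteq> T \<longrightarrow> T = S)"
proof -
  obtain B where B: "finite B" "span B = UNIV"
    using finite_dim by blast
  \<comment> \<open>\<open>finite_dim\<close> gives only a finite spanning set; the dimension theory
    needs a basis.\<close>
  obtain B' where B': "B' \<subseteq> B" "independent B'" "span B' = UNIV"
    using maximal_independent_subset[of B] B(2) by (metis span_span span_mono top.extremum_unique)
  interpret fd: finite_dimensional_vector_space scale B'
    using B' B(1) by unfold_locales (auto intro: finite_subset)
  have "\<forall>S. Q S \<longrightarrow> dim S < Suc fd.dimension"
    by (auto intro: le_imp_less_Suc fd.dim_subset_UNIV)
  then obtain S where S: "Q S" "\<And>T. Q T \<Longrightarrow> dim T \<le> dim S"
    using ex_has_greatest_nat[of Q S0 dim "Suc fd.dimension"] assms(1) by blast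
  have "T = S" if "Q T" "S \<subseteq> T" for T
    using fd.subspace_dim_equal[of S T] S that assms(2) by metis
  with S show ?thesis by blast
qed

end

section \<open>The symplectic form and orthogonals\<close>

context symplectic_lie_algebra
begin

lemma form_zero [simp]: "\<omega> 0 v = 0"
  by (rule module_hom.zero[OF form_hom_left])

lemma form_add_left: "\<omega> (x + y) v = \<omega> x v + \<omega> y v"
  by (rule module_hom.add[OF form_hom_left])

lemma form_scale_left: "\<omega> (a *s x) v = a * \<omega> x v"
  by (rule module_hom.scale[OF form_hom_left])

lemma form_add_right: "\<omega> v (x + y) = \<omega> v x + \<omega> v y"
  using module_hom.add linear_form_right module_hom_iff_linear by blast

lemma form_skew: "\<omega> x y = - \<omega> y x"
proof -
  have "\<omega> (x + y) (x + y) = 0" by (rule form_self)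
  then have "\<omega> x y + \<omega> y x = 0"
    unfolding form_add_left form_add_right by (simp add: form_self add.commute[of "\<omega> y x"])
  then show ?thesis by (simp add: eq_neg_iff_add_eq_0)
qed

lemma form_eq_0_sym: "\<omega> x y = 0 \<Longrightarrow> \<omega> y x = 0"
  using form_skew[of x y] by simp

lemma form_minus_left: "\<omega> (- x) v = - \<omega> x v"
  using module_hom.neg[OF form_hom_left] by blast

lemma orth_antimono: "S \<subseteq> T \<Longrightarrow> orth T \<subseteq> orth S"
  by (auto simp: orth_def)

lemma subset_orth_span:
  assumes "S \<subseteq> orth S"
  shows "span S \<subseteq> orth (span S)"
proof -
  have "span S \<subseteq> orth S"
    using assms by (simp add: span_minimal subspace_orth)
  then have "S \<subseteq> orth (span S)"
    using form_eq_0_sym unfolding orth_def by blast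
  then show ?thesis
    by (simp add: span_minimal subspace_orth)
qed

text \<open>Closedness at \<open>x\<close>, \<open>v\<close>, \<open>l\<close> leaves
  \<open>\<omega> (bracket l x) v\<close>, which vanishes since \<open>bracket l x\<close> is in
  \<open>L\<close>.\<close>

lemma lie_ideal_orth:
  assumes "lie_ideal L" and "\<And>v l. v \<in> orth L \<Longrightarrow> l \<in> L \<Longrightarrow> bracket v l = 0"
  shows "lie_ideal (orth L)"
proof -
  have "\<omega> (bracket x v) l = 0" if v: "v \<in> orth L" and l: "l \<in> L" for x v l
  proof -
    have "bracket l x \<in> L"
      using assms(1) l bracket_skew[of l x] subspace_neg by (auto simp: ideal_of_def)
    then have "\<omega> (bracket l x) v = 0"
      using v form_eq_0_sym by (simp add: orth_def)
    then show ?thesis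
      using closed_form[of x v l] assms(2)[OF v l] by simp
  qed
  then have "bracket x v \<in> orth L" if "v \<in> orth L" for x v
    using that by (simp add: orth_def)
  then show ?thesis
    by (simp add: ideal_of_def subspace_orth)
qed

text \<open>
  With \<open>D = [\<xi>, _]\<close>, the terms \<open>s j = (-1)\<^sup>j \<omega>(D\<^sup>n\<^sup>-\<^sup>ju, D\<^sup>jv)\<close> form an arithmetic progression, whose
  extreme terms vanish.
\<close>

lemma form_bracket_funpow_eq_0:
  assumes M: "lie_ideal M"
    and central: "\<And>u v. u \<in> M \<Longrightarrow> v \<in> M \<Longrightarrow> bracket \<xi> (bracket u v) = 0"
    and D: "\<And>u v. u \<in> M \<Longrightarrow> v \<in> M \<Longrightarrow> \<omega> ((bracket \<xi> ^^ Suc m) u) v = 0"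
    and u: "u \<in> M" and v: "v \<in> M"
  shows "\<omega> (bracket ((bracket \<xi> ^^ m) u) v) \<xi> = 0"
proof -
  let ?D = "bracket \<xi>"
  have M': "(?D ^^ i) w \<in> M" if "w \<in> M" for i w
    using that M by (induction i) (auto simp: ideal_of_def)
  have deriv: "\<omega> (?D x) y + \<omega> x (?D y) = - \<omega> (bracket x y) \<xi>" for x y
    using closed_form[of x y \<xi>] bracket_skew[of y \<xi>] form_skew[of "?D y" x]
    by (simp add: form_minus_left eq_neg_iff_add_eq_0 algebra_simps)
  have skew: "\<omega> (bracket x (?D y)) \<xi> = - \<omega> (bracket (?D x) y) \<xi>" if "x \<in> M" "y \<in> M" for x y
  proof -
    have "bracket (?D x) y + bracket x (?D y) = 0"
      using bracket_leibniz[of \<xi> x y] central[OF that] by simp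
    then have "bracket x (?D y) = - bracket (?D x) y"
      by (metis add.commute eq_neg_iff_add_eq_0)
    then show ?thesis by (simp add: form_minus_left)
  qed
  \<comment> \<open>Each \<open>?D\<close> moved from the right argument to the left costs a
    sign.\<close>
  have shift: "\<omega> (bracket ((?D ^^ i) u) ((?D ^^ j) v)) \<xi>
      = (-1) ^ j * \<omega> (bracket ((?D ^^ (i + j)) u) v) \<xi>" for i j
  proof (induction j arbitrary: i)
    case (Suc j)
    have "\<omega> (bracket ((?D ^^ i) u) ((?D ^^ Suc j) v)) \<xi>
        = - \<omega> (bracket ((?D ^^ Suc i) u) ((?D ^^ j) v)) \<xi>"
      using skew[OF M'[OF u, of i] M'[OF v, of j]] by simp
    then show ?case using Suc[of "Suc i"] by simp
  qed simp
  define c where "c = \<omega> (bracket ((?D ^^ m) u) v) \<xi>"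
  define s where "s j = (-1) ^ j * \<omega> ((?D ^^ (Suc m - j)) u) ((?D ^^ j) v)" for j
  have step: "s (Suc j) - s j = c" if "j \<le> m" for j
  proof -
    have "s (Suc j) - s j = - ((-1) ^ j) *
        (\<omega> (?D ((?D ^^ (m - j)) u)) ((?D ^^ j) v) + \<omega> ((?D ^^ (m - j)) u) (?D ((?D ^^ j) v)))"
      using that by (simp add: s_def Suc_diff_le algebra_simps)
    also have "\<dots> = (-1) ^ j * ((-1) ^ j * c)"
      unfolding deriv shift using that by (simp add: c_def)
    also have "\<dots> = c"
      by (simp add: mult.assoc[symmetric] power_add[symmetric] flip: mult_2)
    finally show ?thesis .
  qed
  have "s (Suc m) - s 0 = (\<Sum>j<Suc m. s (Suc j) - s j)"
    by (rule sum_lessThan_telescope[symmetric])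
  also have "\<dots> = of_nat (Suc m) * c"
    using step by simp
  finally have "of_nat (Suc m) * c = s (Suc m) - s 0" by simp
  moreover have "s 0 = 0"
    using D[OF u v] by (simp add: s_def)
  \<comment> \<open>Here all of \<open>?D ^^ Suc m\<close> falls on \<open>v\<close>, so
    \<open>D\<close> applies with \<open>u\<close> and \<open>v\<close> exchanged.\<close>
  moreover have "s (Suc m) = 0"
    using form_eq_0_sym[OF D[OF v u]] by (simp add: s_def)
  ultimately have "of_nat (Suc m) * c = 0" by simp
  \<comment> \<open>Characteristic 0 allows division by \<open>Suc m\<close>.\<close>
  then show ?thesis
    unfolding c_def[symmetric] by (metis mult_eq_0_iff nat.distinct(1) of_nat_eq_0_iff)
qed

section \<open>Isotropic ideals and their enlargement\<close>

definition reducing_ideal :: "'v \<Rightarrow> 'v set \<Rightarrow> bool" where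
  "reducing_ideal H L \<longleftrightarrow>
    lie_ideal L \<and> H \<in> L \<and> L \<subseteq> orth L \<and> (\<forall>v\<in>orth L. \<forall>l\<in>L. bracket v l = 0)"

lemma reducing_ideal_span_central:
  assumes "central H"
  shows "reducing_ideal H (span {H})"
proof -
  have *: "bracket x y = 0" if "y \<in> span {H}" for x y
    using that assms bracket_skew[of x H] by (auto simp: span_singleton bracket_scale central_def)
  have "{H} \<subseteq> orth {H}" by (simp add: orth_def form_self)
  then show ?thesis
    using * subset_orth_span[of "{H}"]
    by (auto simp: reducing_ideal_def ideal_of_def span_zero span_base)
qed

text \<open>Since \<open>orth\<close> reverses inclusions, commuting with \<open>v\<close> need only
  be known on \<open>orth L\<close>.\<close>

lemma reducing_ideal_insert:
  assumes L: "reducing_ideal H L" and v: "v \<in> orth L" and vL: "\<And>x. bracket x v \<in> L"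
    and comm: "\<And>w. w \<in> orth L \<Longrightarrow> bracket v w = 0"
  shows "reducing_ideal H (span (insert v L))"
proof -
  let ?N = "span (insert v L)"
  have sub: "subspace L" and id: "\<And>x l. l \<in> L \<Longrightarrow> bracket x l \<in> L"
    using L by (auto simp: reducing_ideal_def ideal_of_def)
  have decomp: "\<exists>k l. l \<in> L \<and> y = k *s v + l" if y: "y \<in> ?N" for y
  proof -
    obtain k where "y - k *s v \<in> L"
      using y span_eq_iff[THEN iffD2, OF sub] by (auto simp: span_insert)
    then show ?thesis by (intro exI[of _ k] exI[of _ "y - k *s v"]) simp
  qed
  have "insert v L \<subseteq> orth (insert v L)"
    using L v form_eq_0_sym by (auto simp: reducing_ideal_def orth_def form_self)
  then have "?N \<subseteq> orth ?N" by (rule subset_orth_span)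
  moreover have "bracket x y \<in> L" if y: "y \<in> ?N" for x y
    using decomp[OF y] id vL sub
    by (auto simp: bracket_add bracket_scale intro!: subspace_add subspace_scale)
  moreover have "L \<subseteq> ?N" by (auto intro: span_base)
  moreover have "bracket w y = 0" if w: "w \<in> orth ?N" and y: "y \<in> ?N" for w y
  proof -
    have "w \<in> orth L" using orth_antimono[OF \<open>L \<subseteq> ?N\<close>] w by blast
    then show ?thesis
      using decomp[OF y] comm[of w] bracket_skew[of w v] L
      by (auto simp: bracket_add bracket_scale reducing_ideal_def)
  qed
  ultimately show ?thesis
    using L by (auto simp: reducing_ideal_def ideal_of_def)
qed

lemma center_orth_not_subset:
  assumes nil: nilpotent_lie and H: "central H" and red: "reduction_abelian H"
    and L: "reducing_ideal H L" and ne: "\<not> orth L \<subseteq> L"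
  shows "\<exists>v\<in>orth L. v \<notin> L \<and> (\<forall>w\<in>orth L. bracket v w = 0)"
proof -
  have HL: "H \<in> L" and 0: "0 \<in> L"
    using L by (auto simp: reducing_ideal_def ideal_of_def subspace_0)
  have oL: "lie_ideal (orth L)"
    using L lie_ideal_orth by (auto simp: reducing_ideal_def)
  have "orth L \<subseteq> orth {H}" using HL by (intro orth_antimono) simp
  moreover have "lie_subalgebra (orth {H})"
    using lie_ideal_orth_central[OF H] by (auto simp: lie_subalgebra_def ideal_of_def)
  ultimately have spanH: "bracket u v \<in> span {H}" if "u \<in> orth L" "v \<in> orth L" for u v
    using quotient_abelian_imp_bracket_mem[OF _ ideal_of_orth_span_central[OF H]] red that
    by (auto simp: reduction_abelian_def)
  show ?thesis
  proof (cases "H = 0")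
    \<comment> \<open>Now \<open>span {H}\<close> is zero, so \<open>orth L\<close> is abelian and
      any of its elements outside \<open>L\<close> will do.\<close>
    case True
    then show ?thesis using ne spanH by auto
  next
    case False
    then obtain \<xi> where \<xi>: "\<omega> H \<xi> \<noteq> 0" using nondegenerate by blast
    define P where "P n \<longleftrightarrow> (\<forall>u\<in>orth L. (bracket \<xi> ^^ n) u \<in> L)" for n
    obtain n where "lower_central_series n = {0}"
      using nil by (auto simp: nilpotent_lie_def)
    then have "P n"
      using funpow_bracket_in_lower_central_series[of n \<xi>] 0 by (auto simp: P_def)
    moreover have "\<not> P 0" using ne by (auto simp: P_def)
    ultimately obtain m where m: "\<not> P m" "P (Suc m)"
      using ex_least_nat_less[of P n] by auto
    then obtain u where u: "u \<in> orth L" "(bracket \<xi> ^^ m) u \<notin> L"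
      by (auto simp: P_def)
    let ?v = "(bracket \<xi> ^^ m) u"
    have v: "?v \<in> orth L"
      using u(1) oL by (induction m) (auto simp: ideal_of_def)
    have "bracket ?v w = 0" if w: "w \<in> orth L" for w
    proof -
      have "\<omega> (bracket ?v w) \<xi> = 0"
      proof (rule form_bracket_funpow_eq_0[OF oL _ _ u(1) w])
        fix x y assume xy: "x \<in> orth L" "y \<in> orth L"
        show "bracket \<xi> (bracket x y) = 0"
          using spanH[OF xy] H bracket_skew[of \<xi> H]
          by (auto simp: span_singleton bracket_scale central_def)
        have "(bracket \<xi> ^^ Suc m) x \<in> L" using m(2) xy(1) by (simp only: P_def)
        then show "\<omega> ((bracket \<xi> ^^ Suc m) x) y = 0"
          using xy(2) form_eq_0_sym by (simp add: orth_def del: funpow.simps)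
      qed
      \<comment> \<open>The bracket is a multiple of \<open>H\<close>, and
        \<open>\<omega> H \<xi>\<close> is nonzero.\<close>
      then show ?thesis
        using spanH[OF v w] \<xi> by (auto simp: span_singleton form_scale_left)
    qed
    with u v show ?thesis by blast
  qed
qed

lemma exists_lagrangian_ideal:
  assumes nil: nilpotent_lie and H: "central H" and red: "reduction_abelian H"
  shows "\<exists>L. lagrangian_ideal L"
proof -
  have "\<exists>L. reducing_ideal H L \<and> (\<forall>T. reducing_ideal H T \<longrightarrow> L \<subseteq> T \<longrightarrow> T = L)"
    using reducing_ideal_span_central[OF H]
    by (rule exists_maximal_subspace) (auto simp: reducing_ideal_def ideal_of_def)
  then obtain L where L: "reducing_ideal H L"
    and max: "\<And>T. reducing_ideal H T \<Longrightarrow> L \<subseteq> T \<Longrightarrow> T = L"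
    by blast
  have Lid: "lie_ideal L" and isotropic: "L \<subseteq> orth L"
    using L by (auto simp: reducing_ideal_def)
  have oL: "lie_ideal (orth L)"
    using L lie_ideal_orth by (auto simp: reducing_ideal_def)
  have "orth L \<subseteq> L"
  proof (rule ccontr)
    assume ne: "\<not> orth L \<subseteq> L"
    define K where "K = {v \<in> orth L. \<forall>w\<in>orth L. bracket v w = 0}"
    have "subspace K"
      using subspace_orth[of L]
      by (auto simp: K_def subspace_def bracket_add bracket_scale)
    moreover have "bracket x v \<in> K" if "v \<in> K" for x v
    proof -
      \<comment> \<open>In the Leibniz rule for \<open>bracket x (bracket v w)\<close> the other two
        terms vanish, as \<open>bracket x w\<close> is again in \<open>orth L\<close>.\<close>
      have "bracket (bracket x v) w = 0" if "w \<in> orth L" for w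
        using bracket_leibniz[of x v w] \<open>v \<in> K\<close> that oL by (auto simp: K_def ideal_of_def)
      then show ?thesis
        using that oL by (auto simp: K_def ideal_of_def)
    qed
    ultimately have "lie_ideal K" by (simp add: ideal_of_def)
    moreover have "\<not> K \<subseteq> L"
      using center_orth_not_subset[OF nil H red L ne] by (auto simp: K_def)
    ultimately obtain v where v: "v \<in> K" "v \<notin> L" "\<And>x. bracket x v \<in> L"
      using nilpotent_exists_central_modulo[OF nil _ Lid] by blast
    have "reducing_ideal H (span (insert v L))"
      using v by (intro reducing_ideal_insert[OF L]) (auto simp: K_def)
    then have "span (insert v L) = L"
      by (rule max) (auto intro: span_base)
    then show False using v(2) span_base[of v "insert v L"] by simp
  qed
  then show ?thesis
    using Lid isotropic by (auto simp: lagrangian_ideal_def)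
qed

end

theorem theorem7p11:
  fixes scale :: "'k::field_char_0 \<Rightarrow> 'v::ab_group_add \<Rightarrow> 'v"
    and bracket :: "'v \<Rightarrow> 'v \<Rightarrow> 'v"
    and \<omega> :: "'v \<Rightarrow> 'v \<Rightarrow> 'k"
    and H :: 'v
  assumes "symplectic_lie_algebra scale bracket \<omega>"
    and "lie_algebra.nilpotent_lie scale bracket"
    and "lie_algebra.central bracket H"
    and "symplectic_lie_algebra.reduction_abelian scale bracket \<omega> H"
  shows "\<exists>L. symplectic_lie_algebra.lagrangian_ideal scale bracket \<omega> L"
  using assms by (rule symplectic_lie_algebra.exists_lagrangian_ideal)

end
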